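(* Let $\mathcal{I}_1,\dots,\mathcal{I}_s$ be subsets of $[n]=\{1,\dots,n\}$ with $\bigcup_{i=1}^s\mathcal{I}_i=[n]$ such that $(\mathcal{I}_1,\dots,\mathcal{I}_s)$ satisfies the running intersection property, $\mathcal{I}_i\not\subseteq\mathcal{I}_j$ for any distinct $i,j\in[s]$, and $\mathcal{I}_{i+1}\cap\bigcup_{j=1}^i\mathcal{I}_j\neq\emptyset$ for all $i\in[s-1]$. Let $\hat{\mathcal{I}}_i=\mathcal{I}_i\cup\mathcal{J}_i$, with $\mathcal{J}_i$ the set of indices of auxiliary variables defined in the context. Then $(\hat{\mathcal{I}}_1,\dots,\hat{\mathcal{I}}_s)$ satisfies the running intersection property.
   Context: A tuple of sets $(S_1,\dots,S_s)$ satisfies the running intersection property (RIP) if for every $i\in[s-1]$ there is $t\le i$ with $S_{i+1}\cap\bigcup_{j=1}^iS_j\subseteq S_t$. $A$ is the set of arcs on the node set $[s]$ consisting of the pairs $(i+1,t)$, $i=1,\dots,s-1$, where $t$ is the largest index $t\le i$ with $\mathcal{I}_{i+1}\cap\bigcup_{j=1}^i\mathcal{I}_j\subseteq\mathcal{I}_t$. Put $\mathcal{D}_i=\{t:(t,i)\in A\}$, $\mathcal{A}_i=\{t:(i,t)\in A\}$, and $\mathcal{C}_{i,t}=\mathcal{I}_i\cap\mathcal{I}_t$ for $(i,t)\in A$. For $i\in[s]$, $$\mathcal{J}_i=\{(i,t,k):t\in\mathcal{A}_i,\ k\in\mathcal{C}_{i,t}\}\cup\{(t,i,k):t\in\mathcal{D}_i,\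 k\in\mathcal{C}_{t,i}\}.$$ The elements of $\mathcal{I}_i$ (integers, indexing original variables $x_k$) and of $\mathcal{J}_i$ (triples, indexing auxiliary variables $\nu_{i,t,k}$) are of different kinds, so $\mathcal{I}_i\cap\mathcal{J}_j=\emptyset$ for all $i,j\in[s]$. *)

theory Defs
  imports Main
begin

text \<open>A tuple \<open>(S\<^sub>1, \<dots>, S\<^sub>s)\<close> is a function on \<^typ>\<open>nat\<close> together with its length \<open>s\<close>; only the
  values at \<open>1, \<dots>, s\<close> matter.\<close>

definition running_intersection :: "nat \<Rightarrow> (nat \<Rightarrow> 'a set) \<Rightarrow> bool" where
  "running_intersection s S \<longleftrightarrow>
     (\<forall>i\<in>{1..s - 1}. \<exists>t\<in>{1..i}. S (i + 1) \<inter> (\<Union>j\<in>{1..i}. S j) \<subseteq> S t)"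

definition arcs :: "nat \<Rightarrow> (nat \<Rightarrow> 'a set) \<Rightarrow> (nat \<times> nat) set" where
  "arcs s I = {(i + 1, t) | i t. i \<in> {1..s - 1} \<and> t \<in> {1..i} \<and>
     I (i + 1) \<inter> (\<Union>j\<in>{1..i}. I j) \<subseteq> I t \<and>
     (\<forall>t'\<in>{1..i}. I (i + 1) \<inter> (\<Union>j\<in>{1..i}. I j) \<subseteq> I t' \<longrightarrow> t' \<le> t)}"

definition in_nbrs :: "nat \<Rightarrow> (nat \<Rightarrow> 'a set) \<Rightarrow> nat \<Rightarrow> nat set" where
  "in_nbrs s I i = {t. (t, i) \<in> arcs s I}"

definition out_nbrs :: "nat \<Rightarrow> (nat \<Rightarrow> 'a set) \<Rightarrow> nat \<Rightarrow> nat set" where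
  "out_nbrs s I i = {t. (i, t) \<in> arcs s I}"

definition common :: "(nat \<Rightarrow> 'a set) \<Rightarrow> nat \<Rightarrow> nat \<Rightarrow> 'a set" where
  "common I i t = I i \<inter> I t"

definition aux_indices :: "nat \<Rightarrow> (nat \<Rightarrow> 'a set) \<Rightarrow> nat \<Rightarrow> (nat \<times> nat \<times> 'a) set" where
  "aux_indices s I i =
     {(i, t, k) | t k. t \<in> out_nbrs s I i \<and> k \<in> common I i t} \<union>
     {(t, i, k) | t k. t \<in> in_nbrs s I i \<and> k \<in> common I t i}"

text \<open>Indices of original and of auxiliary variables are of different kinds, so the union of
  \<open>I i\<close> and \<open>aux_indices s I i\<close> is taken as a disjoint sum.\<close>

definition extended :: "nat \<Rightarrow> (nat \<Rightarrow> 'a set) \<Rightarrow> nat \<Rightarrow> ('a + nat \<times> nat \<times> 'a) set" where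
  "extended s I i = I i <+> aux_indices s I i"

end

theory Submission
  imports Defs
begin

lemma arcsD: "(a, b) \<in> arcs s I \<Longrightarrow> b < a"
  by (auto simp: arcs_def)

text \<open>Both heads are the largest admissible index for the same tail, so each is at most the
  other.\<close>

lemma arcs_unique: "(a, b) \<in> arcs s I \<Longrightarrow> (a, c) \<in> arcs s I \<Longrightarrow> b = c"
  by (fastforce simp: arcs_def intro: antisym)

text \<open>The running intersection property supplies some admissible \<open>t\<close>, while an
  arc requires the largest one. It exists because the candidates form a nonempty subset of the
  finite set \<open>{1..i}\<close>.\<close>

lemma arcs_exists:
  assumes "running_intersection s I" and i: "i \<in> {1..s - 1}"
  obtains t where "t \<in> {1..i}" "(i + 1, t) \<in> arcs s I"
    "I (i + 1) \<inter> (\<Union>j\<in>{1..i}. I j) \<subseteq> I t"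
proof -
  define T where "T = {t\<in>{1..i}. I (i + 1) \<inter> (\<Union>j\<in>{1..i}. I j) \<subseteq> I t}"
  have "finite T" "T \<noteq> {}"
    using assms unfolding T_def running_intersection_def by (simp, blast)
  then have "Max T \<in> T" "\<forall>t\<in>T. t \<le> Max T"
    by simp_all
  then have "Max T \<in> {1..i}" "I (i + 1) \<inter> (\<Union>j\<in>{1..i}. I j) \<subseteq> I (Max T)"
    "\<forall>t\<in>{1..i}. I (i + 1) \<inter> (\<Union>j\<in>{1..i}. I j) \<subseteq> I t \<longrightarrow> t \<le> Max T"
    unfolding T_def by blast+
  with i that show thesis
    unfolding arcs_def by blast
qed

text \<open>A triple records its own arc, so the outgoing and incoming halves of
  \<open>aux_indices\<close> differ only in which end of that arc \<open>i\<close> is.\<close>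

lemma mem_aux_indices_iff:
  "(a, b, k) \<in> aux_indices s I i \<longleftrightarrow>
     (a, b) \<in> arcs s I \<and> k \<in> I a \<inter> I b \<and> (i = a \<or> i = b)"
  by (auto simp: aux_indices_def out_nbrs_def in_nbrs_def common_def)

text \<open>An auxiliary index lies only in the sets of the two ends of its arc. Hence \<open>i + 1\<close> shares
  auxiliary indices with an earlier node only along its unique outgoing arc, whose end \<open>t\<close> also
  witnesses the property for the original sets.\<close>

lemma running_intersection_extended:
  assumes "running_intersection s I"
  shows "running_intersection s (extended s I)"
  unfolding running_intersection_def
proof
  fix i assume "i \<in> {1..s - 1}"
  with assms obtain t where t: "t \<in> {1..i}" and arc: "(i + 1, t) \<in> arcs s I"
    and sub: "I (i + 1) \<inter> (\<Union>j\<in>{1..i}. I j) \<subseteq> I t"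
    by (rule arcs_exists)
  have "x \<in> extended s I t"
    if x: "x \<in> extended s I (i + 1)" "x \<in> extended s I j" and j: "j \<in> {1..i}" for x j
  proof (cases x)
    case (Inl k)
    then have "k \<in> I (i + 1)" "k \<in> I j"
      using x by (auto simp: extended_def)
    with j sub have "k \<in> I t"
      by blast
    with Inl show ?thesis
      by (auto simp: extended_def)
  next
    case (Inr y)
    obtain a b k where y: "y = (a, b, k)"
      by (cases y)
    have *: "(a, b, k) \<in> aux_indices s I (i + 1)" "(a, b, k) \<in> aux_indices s I j"
      using x Inr y by (auto simp: extended_def)
    then have "(a, b) \<in> arcs s I"
      by (simp add: mem_aux_indices_iff)
    \<comment> \<open>Both \<open>i + 1\<close> and \<open>j\<close> are ends of the arc. Arcs point
      to smaller indices, so \<open>b = i + 1\<close> would force both ends to be at least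
      \<open>i + 1\<close>, although \<open>j \<le> i\<close>.\<close>
    moreover from this have "a = i + 1"
      using * j by (auto simp: mem_aux_indices_iff dest: arcsD)
    ultimately have "b = t"
      using arc arcs_unique by blast
    \<comment> \<open>The conditions on the arc and on \<open>k\<close> do not depend on the node,
      so they carry over from \<open>i + 1\<close> to the other end \<open>t\<close>.\<close>
    with * have "(a, b, k) \<in> aux_indices s I t"
      by (simp add: mem_aux_indices_iff)
    with Inr y show ?thesis
      by (auto simp: extended_def)
  qed
  with t show "\<exists>t\<in>{1..i}. extended s I (i + 1) \<inter> (\<Union>j\<in>{1..i}. extended s I j) \<subseteq> extended s I t"
    by blast
qed

theorem lemma4p1:
  fixes n s :: nat and I :: "nat \<Rightarrow> nat set"
  assumes "\<forall>i\<in>{1..s}. I i \<subseteq> {1..n}"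
    and "(\<Union>i\<in>{1..s}. I i) = {1..n}"
    and "running_intersection s I"
    and "\<forall>i\<in>{1..s}. \<forall>j\<in>{1..s}. i \<noteq> j \<longrightarrow> \<not> I i \<subseteq> I j"
    and "\<forall>i\<in>{1..s - 1}. I (i + 1) \<inter> (\<Union>j\<in>{1..i}. I j) \<noteq> {}"
  shows "running_intersection s (extended s I)"
  using assms(3) by (rule running_intersection_extended)

end
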